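(* Let $E$ be a normed lattice, $F$ a Banach lattice, and let $A$ be a (norm-)bounded collectively quasi-c-$\sigma$-Levi subset of $\mathrm{L}(E,F)$. Then the set $$\Big\{\sum_{i=1}^\infty\alpha_iT_i:\ T_i\in A \text{ for all } i\in\mathbb{N},\ \alpha_i\in\mathbb{R},\ \sum_{i=1}^\infty|\alpha_i|\le 1\Big\}$$ is collectively quasi-c-$\sigma$-Levi, where $\sum_{i=1}^\infty\alpha_iT_i$ denotes the limit of the partial sums $\sum_{i=1}^n\alpha_iT_i$ in the operator norm.
   Context: Vector spaces are real and operators are linear; $\mathrm{L}(E,F)$ is the space of linear operators from $E$ to $F$. A bounded subset $A$ of $\mathrm{L}(E,F)$ is a set of operators with $\sup_{T\in A}\|T\|<\infty$. For a sequence $(p_n)$ in a vector lattice, $p_n\downarrow 0$ means that $p_{n'}\le p_n$ for all $n'\ge n$ and $\inf_n p_n=0$. A set $A\subseteq \mathrm{L}(E,F)$, with $E$ a normed lattice and $F$ a vector lattice, is collectively quasi-c-$\sigma$-Levi if for every increasing norm-bounded sequence $(x_n)$ in $E_+$ there exist an indexed family $\{y_T\}_{T\in A}$ in $F$ and a sequence $p_n\downarrow 0$ in $F$ such that $|Tx_n-y_T|\le p_n$ for all $n\in\mathbb{N}$ and all $T\in A$. *)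

theory Defs
  imports "HOL-Analysis.Analysis" "HOL-Library.Lattice_Algebras"
begin

class vector_lattice = ordered_real_vector + lattice_ab_group_add_abs

class normed_lattice = vector_lattice + real_normed_vector +
  assumes norm_le_if_abs_le: "\<bar>x\<bar> \<le> \<bar>y\<bar> \<Longrightarrow> norm x \<le> norm y"

class banach_lattice = normed_lattice + banach

instance real :: banach_lattice
  by standard (auto simp: sup_real_def)

(* A vector lattice need not be order complete, so inf p = 0 is spelled out as
   "0 is the greatest lower bound of the range of p". *)
definition decreases_to_zero :: "(nat \<Rightarrow> 'f::vector_lattice) \<Rightarrow> bool" where
  "decreases_to_zero p \<longleftrightarrow>
     decseq p \<and> (\<forall>n. 0 \<le> p n) \<and> (\<forall>z. (\<forall>n. z \<le> p n) \<longrightarrow> z \<le> 0)"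

(* The operators are linear, but neither positive nor continuous in general, and the codomain
   carries no norm; p depends on the sequence x but not on the operator T. *)
definition collectively_quasi_c_sigma_Levi ::
    "('e::normed_lattice \<Rightarrow> 'f::vector_lattice) set \<Rightarrow> bool" where
  "collectively_quasi_c_sigma_Levi A \<longleftrightarrow>
     (\<forall>T\<in>A. linear T) \<and>
     (\<forall>x :: nat \<Rightarrow> 'e. incseq x \<and> (\<forall>n. 0 \<le> x n) \<and> bounded (range x) \<longrightarrow>
       (\<exists>(y :: ('e \<Rightarrow> 'f) \<Rightarrow> 'f) p. decreases_to_zero p \<and>
          (\<forall>n. \<forall>T\<in>A. \<bar>T (x n) - y T\<bar> \<le> p n)))"

(* Absolutely summable combinations from a bounded set of operators converge in the operator norm,
   so suminf denotes the genuine limit of the partial sums. *)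
lemma summable_bounded_operator_combination:
  fixes T :: "nat \<Rightarrow> 'e::real_normed_vector \<Rightarrow>\<^sub>L 'f::banach"
  assumes "bounded A" and T: "\<And>i. T i \<in> A" and "summable (\<lambda>i. \<bar>\<alpha> i\<bar>)"
  shows "summable (\<lambda>i. \<alpha> i *\<^sub>R T i)"
proof -
  obtain M where M: "\<And>S. S \<in> A \<Longrightarrow> norm S \<le> M"
    using \<open>bounded A\<close> unfolding bounded_iff by blast
  have "norm (\<alpha> i *\<^sub>R T i) \<le> \<bar>\<alpha> i\<bar> * M" for i
    using M[OF T[of i]] by (simp add: mult_left_mono)
  then show ?thesis
    by (intro summable_comparison_test'[OF summable_mult2[OF assms(3), of M], of 0])
qed

end

theory Submission imports Defs begin

text \<open>
  If \<open>\<bar>T x\<^sub>n - y\<^sub>T\<bar> \<le> p\<^sub>n\<close> for all \<open>T \<in> A\<close>, then the \<open>y\<^sub>T\<close> are norm bounded because \<open>A\<close> is (take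
  \<open>n = 0\<close>). Hence \<open>\<Sum>i. \<alpha>\<^sub>i y\<^sub>T\<^sub>i\<close> converges absolutely in the Banach lattice \<open>F\<close>, and it serves as the
  limit vector of \<open>\<Sum>i. \<alpha>\<^sub>i T\<^sub>i\<close> with the same sequence \<open>p\<close>: the bound
  \<open>(\<Sum>i. \<bar>\<alpha>\<^sub>i\<bar>) p\<^sub>n \<le> p\<^sub>n\<close> on the partial sums survives in the limit, order intervals being norm closed.
\<close>

text \<open>Since \<open>u n\<close> \<le> \<open>c\<close>, the positive part of
  \<open>l - c\<close> lies below \<bar>\<open>l - u n\<close>\<bar>. Monotonicity of the lattice
  norm bounds its norm by \<open>norm (l - u n)\<close>, which tends to 0, so the positive part
  vanishes.\<close>

lemma LIMSEQ_le_const2_normed_lattice: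
  fixes u :: "nat \<Rightarrow> 'a::normed_lattice"
  assumes lim: "u \<longlonglongrightarrow> l" and le: "\<And>n. u n \<le> c"
  shows "l \<le> c"
proof -
  have le_norm: "norm (sup (l - c) 0) \<le> norm (l - u n)" for n
  proof (rule norm_le_if_abs_le)
    have "l - c \<le> \<bar>l - u n\<bar>"
      using le[of n] by (meson abs_ge_self diff_left_mono order_trans)
    then have "sup (l - c) 0 \<le> \<bar>l - u n\<bar>"
      by simp
    then show "\<bar>sup (l - c) 0\<bar> \<le> \<bar>l - u n\<bar>"
      by (simp add: abs_of_nonneg)
  qed
  have "(\<lambda>n. norm (l - u n)) \<longlonglongrightarrow> norm (l - l)"
    by (intro tendsto_intros lim)
  then have "norm (sup (l - c) 0) \<le> norm (l - l)"
    by (rule LIMSEQ_le_const) (simp add: le_norm)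
  then have "sup (l - c) 0 = 0"
    by simp
  then show ?thesis
    using sup.cobounded1[of "l - c" 0] by simp
qed

lemma abs_scaleR_vector_lattice_le:
  fixes v c :: "'a::vector_lattice"
  assumes "\<bar>v\<bar> \<le> c"
  shows "\<bar>a *\<^sub>R v\<bar> \<le> \<bar>a\<bar> *\<^sub>R c"
proof -
  have bounds: "v \<le> c" "- v \<le> c"
    using assms abs_le_D1 abs_le_D2 by blast+
  have "a *\<^sub>R v \<le> \<bar>a\<bar> *\<^sub>R c" "a *\<^sub>R (- v) \<le> \<bar>a\<bar> *\<^sub>R c"
    using scaleR_left_mono[OF bounds(1), of "\<bar>a\<bar>"] scaleR_left_mono[OF bounds(2), of "\<bar>a\<bar>"]
    by (cases "a \<ge> 0"; simp)+
  then show ?thesis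
    by (intro abs_leI) simp_all
qed

text \<open>Used with \<open>v i\<close> the error of the i-th operator at \<open>x n\<close> and
  \<open>c\<close> = \<open>p n\<close>. The partial sums obey the bound by the triangle inequality;
  it passes to the limit for \<open>s\<close> and \<open>- s\<close> separately, so continuity of
  the absolute value is not called upon.\<close>

lemma abs_sums_scaleR_le:
  fixes v :: "nat \<Rightarrow> 'a::normed_lattice"
  assumes s: "(\<lambda>i. \<alpha> i *\<^sub>R v i) sums s"
    and \<alpha>: "summable (\<lambda>i. \<bar>\<alpha> i\<bar>)" "(\<Sum>i. \<bar>\<alpha> i\<bar>) \<le> 1"
    and v: "\<And>i. \<bar>v i\<bar> \<le> c"
  shows "\<bar>s\<bar> \<le> c"
proof -
  \<comment> \<open>Positivity of \<open>c\<close> lets the factor \<Sum>\<bar>\<alpha> i\<bar> be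
    raised to 1 below.\<close>
  have c: "0 \<le> c"
    using v[of 0] abs_ge_zero order_trans by blast
  have partial: "\<bar>\<Sum>i<n. \<alpha> i *\<^sub>R v i\<bar> \<le> c" for n
  proof -
    have "\<bar>\<Sum>i<n. \<alpha> i *\<^sub>R v i\<bar> \<le> (\<Sum>i<n. \<bar>\<alpha> i *\<^sub>R v i\<bar>)"
      by (rule sum_abs)
    also have "\<dots> \<le> (\<Sum>i<n. \<bar>\<alpha> i\<bar> *\<^sub>R c)"
      by (intro sum_mono abs_scaleR_vector_lattice_le v)
    also have "\<dots> = (\<Sum>i<n. \<bar>\<alpha> i\<bar>) *\<^sub>R c"
      by (simp add: scaleR_sum_left)
    also have "\<dots> \<le> 1 *\<^sub>R c"
      using sum_le_suminf[OF \<alpha>(1), of "{..<n}"] \<alpha>(2) c by (intro scaleR_right_mono) auto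
    finally show ?thesis
      by simp
  qed
  have lim: "(\<lambda>n. \<Sum>i<n. \<alpha> i *\<^sub>R v i) \<longlonglongrightarrow> s"
    using s by (simp add: sums_def)
  show ?thesis
  proof (rule abs_leI)
    show "s \<le> c"
      using lim partial abs_le_D1 by (blast intro: LIMSEQ_le_const2_normed_lattice)
    show "- s \<le> c"
      using tendsto_minus[OF lim] partial abs_le_D2 by (blast intro: LIMSEQ_le_const2_normed_lattice)
  qed
qed

theorem theorem2:
  fixes A :: "('e::normed_lattice \<Rightarrow>\<^sub>L 'f::banach_lattice) set"
  assumes "bounded A"
    and "collectively_quasi_c_sigma_Levi (blinfun_apply ` A)"
  shows "collectively_quasi_c_sigma_Levi (blinfun_apply `
    {(\<Sum>i. \<alpha> i *\<^sub>R T i) | (\<alpha> :: nat \<Rightarrow> real) (T :: nat \<Rightarrow> 'e \<Rightarrow>\<^sub>L 'f).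
       (\<forall>i. T i \<in> A) \<and> summable (\<lambda>i. \<bar>\<alpha> i\<bar>) \<and> (\<Sum>i. \<bar>\<alpha> i\<bar>) \<le> 1})"
    (is "collectively_quasi_c_sigma_Levi (blinfun_apply ` ?B)")
  unfolding collectively_quasi_c_sigma_Levi_def
proof (intro conjI allI impI)
  show "\<forall>T\<in>blinfun_apply ` ?B. linear T"
    by (auto intro: bounded_linear.linear blinfun.bounded_linear_right)
next
  fix x :: "nat \<Rightarrow> 'e"
  assume "incseq x \<and> (\<forall>n. 0 \<le> x n) \<and> bounded (range x)"
  then obtain y :: "('e \<Rightarrow> 'f) \<Rightarrow> 'f" and p where p: "decreases_to_zero p"
    and yp: "\<And>n T. T \<in> A \<Longrightarrow> \<bar>blinfun_apply T (x n) - y (blinfun_apply T)\<bar> \<le> p n"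
    using assms(2) unfolding collectively_quasi_c_sigma_Levi_def by fast
  obtain M where M: "\<And>T. T \<in> A \<Longrightarrow> norm T \<le> M"
    using assms(1) unfolding bounded_iff by blast
  have y_bounded: "norm (y (blinfun_apply T)) \<le> M * norm (x 0) + norm (p 0)" if "T \<in> A" for T
  proof -
    have "norm (blinfun_apply T (x 0) - y (blinfun_apply T)) \<le> norm (p 0)"
      \<comment> \<open>The norm axiom compares absolute values, so \<open>p 0\<close> is first
        enlarged to \<bar>\<open>p 0\<close>\<bar>.\<close>
      using yp[OF that, of 0] by (intro norm_le_if_abs_le) (meson abs_ge_self order_trans)
    moreover have "norm (blinfun_apply T (x 0)) \<le> M * norm (x 0)"
      using norm_blinfun[of T "x 0"] mult_right_mono[OF M[OF that], of "norm (x 0)"] by simp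
    ultimately show ?thesis
      using norm_triangle_sub[of "y (blinfun_apply T)" "blinfun_apply T (x 0)"]
      by (simp add: norm_minus_commute)
  qed
  \<comment> \<open>An operator \<open>S\<close> may be represented by several pairs of \<alpha> and
    \<open>T\<close>, so the limit vector is only shown to exist for each \<open>S\<close>. The
    sequence \<open>p\<close> is already fixed and does not depend on \<open>S\<close>.\<close>
  have "\<exists>z. \<forall>n. \<bar>S (x n) - z\<bar> \<le> p n" if S_in: "S \<in> blinfun_apply ` ?B" for S
  proof -
    obtain \<alpha> T where S: "S = blinfun_apply (\<Sum>i. \<alpha> i *\<^sub>R T i)" and T: "\<And>i. T i \<in> A"
      and \<alpha>: "summable (\<lambda>i. \<bar>\<alpha> i\<bar>)" "(\<Sum>i. \<bar>\<alpha> i\<bar>) \<le> 1"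
      using S_in by blast
    define w where "w i = y (blinfun_apply (T i))" for i
    have "norm (\<alpha> i *\<^sub>R w i) \<le> \<bar>\<alpha> i\<bar> * (M * norm (x 0) + norm (p 0))" for i
      using y_bounded[OF T[of i]] by (simp add: w_def mult_left_mono)
    then have w: "summable (\<lambda>i. \<alpha> i *\<^sub>R w i)"
      by (intro summable_comparison_test'[OF summable_mult2[OF \<alpha>(1)], of 0])
    have "\<bar>S (x n) - (\<Sum>i. \<alpha> i *\<^sub>R w i)\<bar> \<le> p n" for n
    proof (rule abs_sums_scaleR_le[OF _ \<alpha>])
      \<comment> \<open>Evaluation at \<open>x n\<close> is bounded linear in the operator, so
        convergence in operator norm gives convergence at \<open>x n\<close>.\<close>
      have "(\<lambda>i. blinfun_apply (\<alpha> i *\<^sub>R T i) (x n)) sums S (x n)"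
        unfolding S using summable_bounded_operator_combination[OF assms(1) T \<alpha>(1)]
        by (intro bounded_linear.sums[OF blinfun.bounded_linear_left] summable_sums)
      then show "(\<lambda>i. \<alpha> i *\<^sub>R (blinfun_apply (T i) (x n) - w i)) sums
          (S (x n) - (\<Sum>i. \<alpha> i *\<^sub>R w i))"
        using sums_diff[OF _ summable_sums[OF w]]
        by (simp add: blinfun.scaleR_left scaleR_diff_right)
      show "\<bar>blinfun_apply (T i) (x n) - w i\<bar> \<le> p n" for i
        using yp[OF T] by (simp add: w_def)
    qed
    then show ?thesis
      by blast
  qed
  then have "\<forall>S\<in>blinfun_apply ` ?B. \<exists>z. \<forall>n. \<bar>S (x n) - z\<bar> \<le> p n"
    by (rule ballI)
  \<comment> \<open>The axiom of choice selects one limit vector per operator, which gives the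
    required indexed family.\<close>
  then obtain z where z: "\<forall>S\<in>blinfun_apply ` ?B. \<forall>n. \<bar>S (x n) - z S\<bar> \<le> p n"
    unfolding bchoice_iff by (rule exE)
  show "\<exists>(y :: ('e \<Rightarrow> 'f) \<Rightarrow> 'f) p. decreases_to_zero p \<and>
      (\<forall>n. \<forall>T\<in>blinfun_apply ` ?B. \<bar>T (x n) - y T\<bar> \<le> p n)"
    by (intro exI[of _ z] exI[of _ p] conjI allI ballI p z[rule_format])
qed

end
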